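(* Let $X$ be a normed space, let $F\subseteq X$ be a nonempty closed convex set, and let $Q\subseteq X$ be nonempty. Suppose that one of the following holds: (i) $X$ is a reflexive Banach space, $Q$ is a bounded weakly closed set, and $0\in F$; (ii) $Q$ is a compact set and $0\in F$. Then the function $\mathcal{T}^F_Q$ is lower semicontinuous.
   Context: Normed spaces are real. For $t\ge 0$, $tF=\{tf: f\in F\}$ (so $0F=\{0\}$), and $\inf\emptyset=\infty$. The minimal time function is $\mathcal{T}^F_Q(x)=\inf\{t\ge 0: (x+tF)\cap Q\ne\emptyset\}\in[0,\infty]$. For $\varphi:X\to(-\infty,\infty]$, $\mathrm{dom}\,\varphi=\{x: \varphi(x)<\infty\}$; $\varphi$ is lower semicontinuous at $\bar x\in\mathrm{dom}\,\varphi$ if $\liminf_{x\to\bar x}\varphi(x)\ge\varphi(\bar x)$, and $\varphi$ is called lower semicontinuous if it is lower semicontinuous at every point of its domain. *)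

theory Defs
  imports "HOL-Analysis.Analysis"
begin

text \<open>Extended-real-valued functions have values in \<^typ>\<open>ereal\<close>, where the infimum of the empty set is
  \<open>\<infinity>\<close>.\<close>

definition minimal_time ::
  "'a::real_vector set \<Rightarrow> 'a set \<Rightarrow> 'a \<Rightarrow> ereal" where
  "minimal_time F Q x =
     Inf {ereal t | t. 0 \<le> t \<and> ((+) x ` ((*\<^sub>R) t ` F)) \<inter> Q \<noteq> {}}"

definition effective_domain :: "('a \<Rightarrow> ereal) \<Rightarrow> 'a set" where
  "effective_domain \<phi> = {x. \<phi> x < \<infinity>}"

text \<open>The limit inferior is over punctured neighbourhoods; including the point itself would not change
  the condition. Points outside the effective domain are not constrained.\<close>

definition lsc_at :: "('a::topological_space \<Rightarrow> ereal) \<Rightarrow> 'a \<Rightarrow> bool" where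
  "lsc_at \<phi> a \<longleftrightarrow> \<phi> a \<le> Liminf (at a) \<phi>"

definition lsc :: "('a::topological_space \<Rightarrow> ereal) \<Rightarrow> bool" where
  "lsc \<phi> \<longleftrightarrow> (\<forall>a\<in>effective_domain \<phi>. lsc_at \<phi> a)"

definition weak_topology :: "'a::real_normed_vector topology" where
  "weak_topology =
     topology_generated_by {blinfun_apply f -` U | (f :: 'a \<Rightarrow>\<^sub>L real) U. open U}"

lift_definition bidual_embedding ::
  "'a::real_normed_vector \<Rightarrow> (('a \<Rightarrow>\<^sub>L real) \<Rightarrow>\<^sub>L real)" is "\<lambda>x f. blinfun_apply f x"
  by (rule blinfun.bounded_linear_left)

definition reflexive_banach :: "'a::real_normed_vector itself \<Rightarrow> bool" where
  "reflexive_banach _ \<longleftrightarrow>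
     complete (UNIV :: 'a set) \<and> surj (bidual_embedding :: 'a \<Rightarrow> _)"

end

theory Submission
  imports Defs
begin

text \<open>If \<open>\<T> y < r < \<T> x\<close> for points \<open>y\<close> arbitrarily close to \<open>x\<close>, choose \<open>q y \<in> Q\<close> with
  \<open>q y - y \<in> r F\<close>; this uses \<open>t F \<subseteq> r F\<close> for \<open>t \<le> r\<close>, which holds since \<open>F\<close> is convex and contains
  \<open>0\<close>. In both cases the points \<open>q y\<close> cluster weakly at some \<open>q \<in> Q\<close>. As \<open>r F\<close> is closed and convex,
  Hahn-Banach separation gives \<open>q - x \<in> r F\<close>, so \<open>\<T> x \<le> r\<close>, a contradiction.
  Hahn-Banach is obtained from minimal sublinear functionals, which are linear; weak compactness from
  Tychonoff's theorem on functions on the dual, whose cluster points are bounded linear functionals and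
  hence, by reflexivity, evaluations.\<close>

section \<open>Hahn-Banach separation\<close>

definition sublinear :: "('a::real_vector \<Rightarrow> real) \<Rightarrow> bool" where
  "sublinear p \<longleftrightarrow> (\<forall>x y. p (x + y) \<le> p x + p y) \<and> (\<forall>t\<ge>0. \<forall>x. p (t *\<^sub>R x) = t * p x)"

lemma sublinear_add: "sublinear p \<Longrightarrow> p (x + y) \<le> p x + p y"
  and sublinear_scaleR: "sublinear p \<Longrightarrow> 0 \<le> t \<Longrightarrow> p (t *\<^sub>R x) = t * p x"
  by (auto simp: sublinear_def)

lemma sublinear_zero: "sublinear p \<Longrightarrow> p 0 = 0"
  using sublinear_scaleR[of p 0 0] by simp

lemma sublinear_minus: "sublinear p \<Longrightarrow> - p (- x) \<le> p x"
  using sublinear_add[of p x "- x"] sublinear_zero[of p] by simp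

lemma sublinear_norm: "sublinear norm"
  by (simp add: sublinear_def norm_triangle_ineq)

text \<open>One inequality for positive scalars is enough: applied to \<open>inverse t\<close> and
  \<open>t *\<^sub>R x\<close> it yields the reverse one.\<close>

lemma sublinearI:
  assumes "\<And>x y. p (x + y) \<le> p x + p y" and "p 0 = 0"
    and le: "\<And>t x. 0 < t \<Longrightarrow> p (t *\<^sub>R x) \<le> t * p x"
  shows "sublinear p"
proof -
  have "p (t *\<^sub>R x) = t * p x" if "0 \<le> t" for t x
  proof (cases "t = 0")
    case False
    with that have t: "0 < t" by simp
    from le[of "inverse t" "t *\<^sub>R x"] t have "t * p x \<le> p (t *\<^sub>R x)"
      by (simp add: field_simps)
    with le[OF t, of x] show ?thesis by simp
  qed (simp add: assms)
  with assms show ?thesis by (simp add: sublinear_def)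
qed

text \<open>The functional is \<open>p y = inf {q (y + t d) - t \<delta> | t \<ge> 0, d \<in> D}\<close>.\<close>
lemma sublinear_decrease_along_convex:
  assumes q: "sublinear q" and D: "convex D" "D \<noteq> {}" and \<delta>: "\<And>d. d \<in> D \<Longrightarrow> \<delta> \<le> q d"
  obtains p where "sublinear p" and "\<And>y. p y \<le> q y"
    and "\<And>y d. d \<in> D \<Longrightarrow> p y \<le> q (y + d) - \<delta>"
proof -
  define S where "S y = {q (y + t *\<^sub>R d) - t * \<delta> | t d. 0 \<le> t \<and> d \<in> D}" for y
  define p where "p y = Inf (S y)" for y
  have mem: "q (y + t *\<^sub>R d) - t * \<delta> \<in> S y" if "0 \<le> t" "d \<in> D" for y t d
    using that by (auto simp: S_def)
  have ne: "S y \<noteq> {}" for y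
    using mem[of 0] D by blast
  \<comment> \<open>This bound keeps the infimum real. It comes from
    \<open>t * \<delta> \<le> q (t *\<^sub>R d)\<close> and from splitting
    \<open>t *\<^sub>R d\<close> into \<open>y + t *\<^sub>R d\<close> and
    \<open>- y\<close>.\<close>
  have lower: "- q (- y) \<le> v" if v: "v \<in> S y" for y v
  proof -
    obtain t d where td: "0 \<le> t" "d \<in> D" "v = q (y + t *\<^sub>R d) - t * \<delta>"
      using v by (auto simp: S_def)
    have "t * \<delta> \<le> q (t *\<^sub>R d)"
      using td by (simp add: sublinear_scaleR[OF q] mult_left_mono \<delta>)
    also have "\<dots> \<le> q (y + t *\<^sub>R d) + q (- y)"
      using sublinear_add[OF q, of "y + t *\<^sub>R d" "- y"] by simp
    finally show ?thesis using td by simp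
  qed
  have bdd: "bdd_below (S y)" for y
    using lower by (auto simp: bdd_below_def)
  have p_le: "p y \<le> q (y + t *\<^sub>R d) - t * \<delta>" if "0 \<le> t" "d \<in> D" for y t d
    unfolding p_def by (rule cInf_lower[OF mem[OF that] bdd])
  have p_le_q: "p y \<le> q y" for y
    using p_le[of 0 _ y] D by auto
  have "sublinear p"
  proof (rule sublinearI)
    fix x y
    have diff_le: "p (x + y) - a \<le> b" if ab: "a \<in> S x" "b \<in> S y" for a b
    proof -
      obtain t d where td: "0 \<le> t" "d \<in> D" "a = q (x + t *\<^sub>R d) - t * \<delta>"
        using ab by (auto simp: S_def)
      obtain s e where se: "0 \<le> s" "e \<in> D" "b = q (y + s *\<^sub>R e) - s * \<delta>"
        using ab by (auto simp: S_def)
      \<comment> \<open>Convexity merges the two shifts: \<open>w\<close> is the mean of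
        \<open>d\<close> and \<open>e\<close> with weights proportional to \<open>t\<close> and
        \<open>s\<close>. If both weights vanish, any point of \<open>D\<close> serves, and
        \<open>d\<close> is taken.\<close>
      obtain w where w: "w \<in> D" "(t + s) *\<^sub>R w = t *\<^sub>R d + s *\<^sub>R e"
      proof (cases "t + s = 0")
        case True
        with td se have "t = 0" "s = 0" by auto
        with that td show ?thesis by simp
      next
        case False
        with td se have pos: "0 < t + s" by simp
        show ?thesis
        proof (rule that)
          show "(t / (t + s)) *\<^sub>R d + (s / (t + s)) *\<^sub>R e \<in> D"
            using td se pos by (intro convexD[OF D(1)]) (auto simp: add_divide_distrib[symmetric])
          show "(t + s) *\<^sub>R ((t / (t + s)) *\<^sub>R d + (s / (t + s)) *\<^sub>R e) = t *\<^sub>R d + s *\<^sub>R e"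
            using pos by (simp add: scaleR_add_right)
        qed
      qed
      have "p (x + y) \<le> q ((x + y) + (t + s) *\<^sub>R w) - (t + s) * \<delta>"
        by (rule p_le) (use td se w in auto)
      also have "(x + y) + (t + s) *\<^sub>R w = (x + t *\<^sub>R d) + (y + s *\<^sub>R e)"
        by (simp add: w)
      also have "q \<dots> \<le> q (x + t *\<^sub>R d) + q (y + s *\<^sub>R e)"
        by (rule sublinear_add[OF q])
      finally show ?thesis using td se by (simp add: algebra_simps)
    qed
    \<comment> \<open>The infima are taken one at a time: over \<open>b\<close> with
      \<open>a\<close> fixed, then over \<open>a\<close>.\<close>
    have "p (x + y) - p y \<le> a" if "a \<in> S x" for a
    proof -
      have "p (x + y) - a \<le> p y"
        unfolding p_def[of y] by (rule cInf_greatest[OF ne diff_le[OF that]])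
      then show ?thesis by simp
    qed
    then have "p (x + y) - p y \<le> p x"
      unfolding p_def[of x] by (rule cInf_greatest[OF ne])
    then show "p (x + y) \<le> p x + p y" by simp
  next
    have "0 \<le> p 0"
      unfolding p_def using lower[of _ 0] ne sublinear_zero[OF q] by (intro cInf_greatest) auto
    then show "p 0 = 0"
      using p_le_q[of 0] sublinear_zero[OF q] by simp
  next
    fix t :: real and x assume t: "0 < t"
    \<comment> \<open>Homogeneity of \<open>q\<close> turns the shift parameter \<open>s\<close> at
      \<open>x\<close> into \<open>t * s\<close> at \<open>t *\<^sub>R x\<close>.\<close>
    have "p (t *\<^sub>R x) / t \<le> p x"
      unfolding p_def[of x]
    proof (rule cInf_greatest[OF ne])
      fix v assume "v \<in> S x"
      then obtain s d where sd: "0 \<le> s" "d \<in> D" "v = q (x + s *\<^sub>R d) - s * \<delta>"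
        by (auto simp: S_def)
      have "p (t *\<^sub>R x) \<le> q (t *\<^sub>R x + (t * s) *\<^sub>R d) - (t * s) * \<delta>"
        by (rule p_le) (use t sd in auto)
      also have "t *\<^sub>R x + (t * s) *\<^sub>R d = t *\<^sub>R (x + s *\<^sub>R d)"
        by (simp add: scaleR_add_right)
      also have "q \<dots> = t * q (x + s *\<^sub>R d)"
        using t by (simp add: sublinear_scaleR[OF q])
      finally have "p (t *\<^sub>R x) \<le> t * v"
        using sd by (simp add: right_diff_distrib)
      then show "p (t *\<^sub>R x) / t \<le> v"
        using t by (simp add: field_simps)
    qed
    then show "p (t *\<^sub>R x) \<le> t * p x"
      using t by (simp add: field_simps)
  qed
  then show thesis
    using that p_le_q p_le[of 1] by simp
qed

text \<open>Provides the bounds of chains for Zorn's lemma. Of two members of the chain the smaller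
  one lies below both, and its subadditivity passes to the infimum; \<open>b\<close> keeps the
  infimum real.\<close>

lemma sublinear_INF_chain:
  assumes C: "C \<noteq> {}" "\<And>f. f \<in> C \<Longrightarrow> sublinear f"
    and lower: "\<And>f x. f \<in> C \<Longrightarrow> b x \<le> f x"
    and chain: "\<And>f g. f \<in> C \<Longrightarrow> g \<in> C \<Longrightarrow> f \<le> g \<or> g \<le> f"
  shows "sublinear (\<lambda>x. INF f\<in>C. f x)"
proof (rule sublinearI)
  have bdd: "bdd_below ((\<lambda>f. f x) ` C)" for x
    using lower[of _ x] by (auto simp: bdd_below_def)
  let ?p = "\<lambda>x. INF f\<in>C. f x"
  have p_le: "?p x \<le> f x" if "f \<in> C" for f x
    by (rule cINF_lower[OF bdd that])
  show "?p (x + y) \<le> ?p x + ?p y" for x y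
  proof -
    have diff_le: "?p (x + y) - f x \<le> g y" if fg: "f \<in> C" "g \<in> C" for f g
    proof -
      obtain h where h: "h \<in> C" "h \<le> f" "h \<le> g"
        using chain[OF fg] fg by auto
      have "?p (x + y) \<le> h x + h y"
        using p_le[OF h(1), of "x + y"] sublinear_add[OF C(2)[OF h(1)], of x y] by simp
      moreover have "h x \<le> f x" "h y \<le> g y"
        using h by (auto simp: le_fun_def)
      ultimately show ?thesis by simp
    qed
    have "?p (x + y) - ?p y \<le> f x" if "f \<in> C" for f
    proof -
      have "?p (x + y) - f x \<le> ?p y"
        by (rule cINF_greatest[OF C(1) diff_le[OF that]])
      then show ?thesis by simp
    qed
    then have "?p (x + y) - ?p y \<le> ?p x"
      by (rule cINF_greatest[OF C(1)])
    then show ?thesis by simp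
  qed
  show "?p 0 = 0"
    using C by (simp add: sublinear_zero cong: INF_cong)
  show "?p (t *\<^sub>R x) \<le> t * ?p x" if t: "0 < t" for t x
  proof -
    have "?p (t *\<^sub>R x) / t \<le> ?p x"
    proof (rule cINF_greatest[OF C(1)])
      fix f assume f: "f \<in> C"
      show "?p (t *\<^sub>R x) / t \<le> f x"
        using p_le[OF f, of "t *\<^sub>R x"] t sublinear_scaleR[OF C(2)[OF f], of t x]
        by (simp add: field_simps)
    qed
    with t show ?thesis by (simp add: field_simps)
  qed
qed

text \<open>Zorn's lemma gives a minimal sublinear \<open>m\<close> below \<open>p\<close>. Lowering
  \<open>m\<close> along a singleton cannot change it, which forces additivity.\<close>

lemma exists_linear_below_sublinear:
  assumes p: "sublinear p"
  obtains f where "linear f" and "\<And>x. f x \<le> p x"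
proof -
  define A where "A = {f. sublinear f \<and> f \<le> p}"
  have "\<exists>m\<in>A. \<forall>a\<in>A. a \<le> m \<longrightarrow> a = m"
  \<comment> \<open>The order is reversed, so that maximal elements are minimal functionals.\<close>
  proof (rule predicate_Zorn[where P = "\<lambda>f g. g \<le> f"])
    show "partial_order_on A (relation_of (\<lambda>f g. g \<le> f) A)"
      by (auto simp: partial_order_on_def preorder_on_def refl_on_def trans_def antisym_def
          relation_of_def)
    fix C assume "C \<in> Chains (relation_of (\<lambda>f g. g \<le> f) A)"
    then have chain: "\<And>f g. f \<in> C \<Longrightarrow> g \<in> C \<Longrightarrow> f \<le> g \<or> g \<le> f" and CA: "C \<subseteq> A"
      by (auto simp: Chains_def relation_of_def)
    show "\<exists>u\<in>A. \<forall>a\<in>C. u \<le> a"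
    proof (cases "C = {}")
      case True
      with p show ?thesis by (auto simp: A_def)
    next
      case False
      let ?u = "\<lambda>x. INF f\<in>C. f x"
      \<comment> \<open>The bound depends on \<open>p\<close> alone, hence is common to all members
        of the chain.\<close>
      have lower: "- p (- x) \<le> f x" if "f \<in> C" for f x
      proof -
        have "sublinear f" "f (- x) \<le> p (- x)"
          using that CA by (auto simp: A_def le_fun_def)
        with sublinear_minus[of f x] show ?thesis by simp
      qed
      have "sublinear ?u"
        using False CA lower chain
        by (intro sublinear_INF_chain[where b = "\<lambda>x. - p (- x)"]) (auto simp: A_def)
      moreover have le: "?u \<le> f" if "f \<in> C" for f
      proof (rule le_funI)
        show "?u x \<le> f x" for x
          by (rule cINF_lower[OF bdd_belowI2[where m = "- p (- x)"] that]) (rule lower)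
      qed
      moreover obtain f where "f \<in> C" "f \<le> p"
        using False CA by (auto simp: A_def)
      ultimately show ?thesis
        by (intro bexI[of _ ?u]) (auto simp: A_def intro: order_trans)
    qed
  qed
  then obtain m where m: "sublinear m" "m \<le> p"
    and minimal: "\<And>f. sublinear f \<Longrightarrow> f \<le> m \<Longrightarrow> f = m"
    by (auto simp: A_def intro: order_trans)
  have add: "m (y + x) = m y + m x" for x y
  proof -
    obtain f where f: "sublinear f" "\<And>y. f y \<le> m y" "\<And>y. f y \<le> m (y + x) - m x"
      \<comment> \<open>By minimality the lowered \<open>f\<close> is \<open>m\<close> itself, so
        its last bound reads \<open>m y \<le> m (y + x) - m x\<close>, the converse of
        subadditivity.\<close>
      by (rule sublinear_decrease_along_convex[OF m(1), of "{x}" "m x"]) auto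
    have "f = m"
      by (rule minimal) (use f in \<open>auto simp: le_fun_def\<close>)
    with f(3)[of y] sublinear_add[OF m(1), of y x] show ?thesis by simp
  qed
  have minus: "m (- x) = - m x" for x
    using add[of x "- x"] sublinear_zero[OF m(1)] by simp
  have "m (t *\<^sub>R x) = t * m x" for t x
  proof (cases "0 \<le> t")
    case False
    then show ?thesis
      using sublinear_scaleR[OF m(1), of "- t" x] minus[of "t *\<^sub>R x"] by simp
  qed (simp add: sublinear_scaleR[OF m(1)])
  with add have "linear m" by (intro linearI) auto
  with m that show thesis by (auto simp: le_fun_def)
qed

text \<open>On the translate of \<open>C\<close> by \<open>- z\<close> the norm is at least
  \<delta>, so it can be lowered along that convex set. A linear functional below the result is
  bounded and separates with gap \<delta>.\<close>

lemma separating_functional: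
  fixes C :: "'a::real_normed_vector set"
  assumes C: "closed C" "convex C" "C \<noteq> {}" and z: "z \<notin> C"
  obtains f :: "'a \<Rightarrow>\<^sub>L real" and \<delta> where "0 < \<delta>" and "\<And>c. c \<in> C \<Longrightarrow> f z + \<delta> \<le> f c"
proof -
  obtain \<delta> where \<delta>: "0 < \<delta>" "ball z \<delta> \<subseteq> - C"
    using C(1) z by (meson ComplI open_Compl openE)
  have dist: "\<delta> \<le> norm (- z + c)" if "c \<in> C" for c
  proof -
    have "c \<notin> ball z \<delta>" using \<delta>(2) that by blast
    then show ?thesis by (simp add: dist_norm norm_minus_commute)
  qed
  let ?D = "(\<lambda>c. - z + c) ` C"
  obtain p where p: "sublinear p" "\<And>y. p y \<le> norm y" "\<And>y d. d \<in> ?D \<Longrightarrow> p y \<le> norm (y + d) - \<delta>"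
  proof (rule sublinear_decrease_along_convex[OF sublinear_norm, of ?D \<delta>])
    show "convex ?D" by (rule convex_translation[OF C(2)])
    show "\<delta> \<le> norm d" if "d \<in> ?D" for d
      using that dist by blast
    show "?D \<noteq> {}" using C(3) by simp
  qed blast
  obtain g where g: "linear g" "\<And>x. g x \<le> p x"
    using exists_linear_below_sublinear[OF p(1)] by blast
  have "\<bar>g x\<bar> \<le> norm x" for x
    using g(2)[of x] g(2)[of "- x"] p(2)[of x] p(2)[of "- x"] linear_neg[OF g(1), of x] by auto
  then have bl: "bounded_linear g"
    using g(1) by (auto simp: bounded_linear_def bounded_linear_axioms_def intro!: exI[of _ 1])
  show thesis
  proof (rule that[OF \<delta>(1), of "Blinfun g"])
    fix c assume c: "c \<in> C"
    \<comment> \<open>At \<open>y = z - c\<close> and \<open>d = - z + c\<close> the norm term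
      vanishes and only \<open>- \<delta>\<close> remains.\<close>
    then have "g (z - c) \<le> - \<delta>"
      using g(2)[of "z - c"] p(3)[of "- z + c" "z - c"] by auto
    then show "Blinfun g z + \<delta> \<le> Blinfun g c"
      using bl linear_diff[OF g(1), of z c] by (simp add: bounded_linear_Blinfun_apply)
  qed
qed

section \<open>Weak cluster points\<close>

text \<open>Filters finer than \<open>H\<close> play the role of subnets. The image filter of
  \<open>H\<close> has a cluster point \<open>l\<close> in \<open>K\<close>; adding the preimages of
  the neighbourhoods of \<open>l\<close> to \<open>H\<close> makes \<open>g\<close>
  converge.\<close>

lemma compact_cluster_filter:
  assumes K: "compact K" and H: "H \<noteq> bot" and ev: "eventually (\<lambda>y. g y \<in> K) H"
  obtains G l where "G \<le> H" "G \<noteq> bot" "l \<in> K" "(g \<longlongrightarrow> l) G"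
proof -
  have "filtermap g H \<noteq> bot" "eventually (\<lambda>x. x \<in> K) (filtermap g H)"
    using H ev by (auto simp: filtermap_bot_iff eventually_filtermap)
  then obtain l where l: "l \<in> K" "inf (nhds l) (filtermap g H) \<noteq> bot"
    using K unfolding compact_filter by blast
  let ?G = "inf H (filtercomap g (nhds l))"
  have "?G \<noteq> bot"
  proof
    assume "?G = bot"
    then obtain P R where PR: "eventually P H" "eventually R (nhds l)" "\<And>y. \<not> (P y \<and> R (g y))"
      by (auto simp: trivial_limit_def eventually_inf eventually_filtercomap)
    then have "eventually (\<lambda>x. \<not> R x) (filtermap g H)"
      by (auto simp: eventually_filtermap elim!: eventually_mono)
    with PR(2) have "eventually (\<lambda>_. False) (inf (nhds l) (filtermap g H))"
      unfolding eventually_inf by blast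
    with l(2) show False by (simp add: trivial_limit_def)
  qed
  moreover have "(g \<longlongrightarrow> l) ?G"
    by (simp add: filterlim_iff_le_filtercomap)
  ultimately show thesis
    by (intro that[OF inf_le1 _ l(1)])
qed

text \<open>Tychonoff's theorem, carried from the product topology to the topology of the function
  type.\<close>

lemma compact_PiE_UNIV:
  fixes K :: "'i \<Rightarrow> 'a::topological_space set"
  assumes "\<And>i. compact (K i)"
  shows "compact (PiE UNIV K)"
proof -
  have "compactin (product_topology (\<lambda>i. euclidean) UNIV) (PiE UNIV K)"
    using assms by (simp add: compactin_PiE)
  then show ?thesis
    by (simp only: euclidean_product_topology compactin_euclidean_iff)
qed

lemma reflexive_bounded_weak_cluster:
  fixes A :: "'a::real_normed_vector set" and g :: "'b \<Rightarrow> 'a"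
  assumes refl: "reflexive_banach TYPE('a)" and A: "bounded A"
    and H: "H \<noteq> bot" and ev: "eventually (\<lambda>y. g y \<in> A) H"
  obtains G l where "G \<le> H" "G \<noteq> bot" "\<And>f :: 'a \<Rightarrow>\<^sub>L real. ((\<lambda>y. f (g y)) \<longlongrightarrow> f l) G"
proof -
  obtain M where M: "\<And>x. x \<in> A \<Longrightarrow> norm x \<le> M"
    using A by (auto simp: bounded_iff)
  define J where "J x = (\<lambda>f :: 'a \<Rightarrow>\<^sub>L real. f x)" for x :: 'a
  \<comment> \<open>The radius comes from \<open>\<bar>f x\<bar> \<le> norm f * norm x\<close>, so
    evaluation at any point of \<open>A\<close> lies in the product of these intervals.\<close>
  define K where "K f = {- (norm f * M)..norm f * M}" for f :: "'a \<Rightarrow>\<^sub>L real"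
  have JK: "J x \<in> PiE UNIV K" if "x \<in> A" for x
  proof -
    have "\<bar>f x\<bar> \<le> norm f * M" for f :: "'a \<Rightarrow>\<^sub>L real"
      using norm_blinfun[of f x] mult_left_mono[OF M[OF that], of "norm f"] by simp
    then show ?thesis by (auto simp: J_def K_def abs_le_iff minus_le_iff)
  qed
  have "compact (PiE UNIV K)"
    by (rule compact_PiE_UNIV) (simp add: K_def)
  moreover have "eventually (\<lambda>y. J (g y) \<in> PiE UNIV K) H"
    using ev by eventually_elim (rule JK)
  ultimately obtain G L where G: "G \<le> H" "G \<noteq> bot" and L: "L \<in> PiE UNIV K"
    and lim: "((\<lambda>y. J (g y)) \<longlongrightarrow> L) G"
    using compact_cluster_filter[OF _ H] by metis
  have limf: "((\<lambda>y. f (g y)) \<longlongrightarrow> L f) G" for f :: "'a \<Rightarrow>\<^sub>L real"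
  proof -
    have "continuous_on UNIV (\<lambda>h :: ('a \<Rightarrow>\<^sub>L real) \<Rightarrow> real. h f)"
      by simp
    from continuous_on_tendsto_compose[OF this lim] show ?thesis
      by (simp add: J_def)
  qed
  \<comment> \<open>Linearity of \<open>L\<close> follows from uniqueness of limits, each evaluation
    being linear in the functional.\<close>
  have "L (f + h) = L f + L h" for f h
  proof (rule tendsto_unique[OF G(2) limf])
    show "((\<lambda>y. (f + h) (g y)) \<longlongrightarrow> L f + L h) G"
      using tendsto_add[OF limf limf] by (simp add: blinfun.add_left)
  qed
  moreover have "L (r *\<^sub>R f) = r *\<^sub>R L f" for r f
  proof (rule tendsto_unique[OF G(2) limf])
    show "((\<lambda>y. (r *\<^sub>R f) (g y)) \<longlongrightarrow> r *\<^sub>R L f) G"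
      using tendsto_scaleR[OF tendsto_const limf] by (simp add: blinfun.scaleR_left)
  qed
  moreover have "norm (L f) \<le> norm f * M" for f
    using PiE_mem[OF L, of f] by (simp add: K_def abs_le_iff)
  ultimately have bl: "bounded_linear L"
    by (rule bounded_linear_intro)
  obtain l where "bidual_embedding l = Blinfun L"
    using refl unfolding reflexive_banach_def by (metis surjD)
  then have "L f = f l" for f
    using bl by (metis bidual_embedding.rep_eq bounded_linear_Blinfun_apply)
  with limf have "((\<lambda>y. f (g y)) \<longlongrightarrow> f l) G" for f :: "'a \<Rightarrow>\<^sub>L real"
    by simp
  then show thesis by (rule that[OF G])
qed

text \<open>Induction on how \<open>U\<close> is generated: for a subbasic set the limit hypothesis
  applies directly, an intersection joins two eventual statements, and for a union the member
  containing \<open>l\<close> suffices.\<close>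

lemma weak_topology_eventually:
  fixes U :: "'a::real_normed_vector set"
  assumes U: "openin weak_topology U" and l: "l \<in> U"
    and lim: "\<And>f :: 'a \<Rightarrow>\<^sub>L real. ((\<lambda>y. f (g y)) \<longlongrightarrow> f l) G"
  shows "eventually (\<lambda>y. g y \<in> U) G"
  using openin_topology_generated_by[OF U[unfolded weak_topology_def]] l
proof (induction rule: generate_topology_on.induct)
  case (Int a b)
  then show ?case by (auto intro: eventually_conj)
next
  case (UN \<K>)
  then obtain k where "k \<in> \<K>" "l \<in> k" by blast
  with UN have "eventually (\<lambda>y. g y \<in> k) G" by blast
  then show ?case by eventually_elim (use \<open>k \<in> \<K>\<close> in blast)
next
  case (Basis s)
  then obtain f :: "'a \<Rightarrow>\<^sub>L real" and V where "s = blinfun_apply f -` V" "open V"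
    by blast
  with Basis show ?case using topological_tendstoD[OF lim[of f]] by simp
qed simp

lemma weakly_closed_limit:
  fixes Q :: "'a::real_normed_vector set"
  assumes Q: "closedin weak_topology Q" and G: "G \<noteq> bot" and ev: "eventually (\<lambda>y. g y \<in> Q) G"
    and lim: "\<And>f :: 'a \<Rightarrow>\<^sub>L real. ((\<lambda>y. f (g y)) \<longlongrightarrow> f l) G"
  shows "l \<in> Q"
proof (rule ccontr)
  assume "l \<notin> Q"
  have top: "topspace weak_topology = (UNIV :: 'a set)"
    unfolding weak_topology_def topology_generated_by_topspace
    using open_UNIV by (auto intro!: exI[of _ "UNIV :: 'a set"])
  have "openin weak_topology (- Q)"
    using Q by (simp add: closedin_def top Compl_eq_Diff_UNIV)
  from weak_topology_eventually[OF this _ lim] \<open>l \<notin> Q\<close>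
  have "eventually (\<lambda>y. g y \<in> - Q) G" by simp
  with ev have "eventually (\<lambda>_. False) G" by eventually_elim simp
  with G show False by (simp add: trivial_limit_def)
qed

text \<open>Mazur's theorem in filter form: a functional separating \<open>l\<close> from
  \<open>C\<close> with gap \<delta> would keep that gap in the limit, giving
  \<open>f l + \<delta> \<le> f l\<close>.\<close>

lemma closed_convex_weak_limit:
  fixes C :: "'a::real_normed_vector set"
  assumes C: "closed C" "convex C" and G: "G \<noteq> bot" and ev: "eventually (\<lambda>y. g y \<in> C) G"
    and lim: "\<And>f :: 'a \<Rightarrow>\<^sub>L real. ((\<lambda>y. f (g y)) \<longlongrightarrow> f l) G"
  shows "l \<in> C"
proof (rule ccontr)
  assume l: "l \<notin> C"
  have "C \<noteq> {}" using ev G by (auto simp: trivial_limit_def)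
  then obtain f :: "'a \<Rightarrow>\<^sub>L real" and \<delta> where f: "0 < \<delta>" "\<And>c. c \<in> C \<Longrightarrow> f l + \<delta> \<le> f c"
    using separating_functional[OF C _ l] by blast
  have "f l + \<delta> \<le> f l"
    by (rule tendsto_lowerbound[OF lim _ G]) (use ev f in \<open>auto elim: eventually_mono\<close>)
  with f(1) show False by simp
qed

section \<open>The minimal time function\<close>

text \<open>For \<open>r > 0\<close> the point \<open>(t / r) *\<^sub>R x\<close> is a convex
  combination of \<open>x\<close> and \<open>0\<close>, hence in \<open>F\<close>.\<close>

lemma convex_scaleR_mono:
  assumes "convex F" "0 \<in> F" "0 \<le> t" "t \<le> r"
  shows "(*\<^sub>R) t ` F \<subseteq> (*\<^sub>R) r ` F"
proof (cases "r = 0")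
  case False
  with assms have r: "0 < r" by simp
  show ?thesis
  proof (clarify)
    fix x assume "x \<in> F"
    then have "(t / r) *\<^sub>R x \<in> F"
      using convexD_alt[OF assms(1,2), of x "t / r"] r assms by simp
    moreover have "t *\<^sub>R x = r *\<^sub>R ((t / r) *\<^sub>R x)" using r by simp
    ultimately show "t *\<^sub>R x \<in> (*\<^sub>R) r ` F" by blast
  qed
qed (use assms in auto)

text \<open>Some admissible time lies below \<open>r\<close>; monotonicity of the dilates replaces
  it by \<open>r\<close>, which is the same for all \<open>y\<close>.\<close>

lemma minimal_time_less_imp:
  assumes F: "convex F" "0 \<in> F" and less: "minimal_time F Q y < ereal r"
  obtains q where "q \<in> Q" "q - y \<in> (*\<^sub>R) r ` F"
proof -
  obtain t f where t: "0 \<le> t" "t < r" and f: "f \<in> F" "y + t *\<^sub>R f \<in> Q"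
    using less unfolding minimal_time_def Inf_less_iff by auto
  show thesis
    by (rule that[OF f(2)]) (use convex_scaleR_mono[OF F t(1), of r] t f in auto)
qed

lemma minimal_time_le:
  assumes "0 \<le> r" "q \<in> Q" "q - x \<in> (*\<^sub>R) r ` F"
  shows "minimal_time F Q x \<le> ereal r"
  unfolding minimal_time_def
proof (rule Inf_lower)
  have "x + (q - x) \<in> (+) x ` ((*\<^sub>R) r ` F)" using assms(3) by blast
  with assms show "ereal r \<in> {ereal t |t. 0 \<le> t \<and> (+) x ` (*\<^sub>R) t ` F \<inter> Q \<noteq> {}}"
    by auto
qed

lemma minimal_time_nonneg: "0 \<le> minimal_time F Q x"
  unfolding minimal_time_def by (rule Inf_greatest) auto

theorem theorem3p2:
  fixes F Q :: "'a::real_normed_vector set"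
  assumes "F \<noteq> {}" and "closed F" and "convex F" and "Q \<noteq> {}"
    and "(reflexive_banach TYPE('a) \<and> bounded Q \<and> closedin weak_topology Q \<and> 0 \<in> F)
         \<or> (compact Q \<and> 0 \<in> F)"
  shows "lsc (minimal_time F Q)"
proof -
  let ?T = "minimal_time F Q"
  have zero: "0 \<in> F" using assms(5) by blast
  \<comment> \<open>Apart from \<open>0 \<in> F\<close>, the two cases enter only through this
    cluster property.\<close>
  have cluster: "\<exists>G l. G \<le> H \<and> G \<noteq> bot \<and> l \<in> Q \<and>
      (\<forall>f :: 'a \<Rightarrow>\<^sub>L real. ((\<lambda>y. f (q y)) \<longlongrightarrow> f l) G)"
    if H: "H \<noteq> bot" "eventually (\<lambda>y. q y \<in> Q) H" for H :: "'a filter" and q :: "'a \<Rightarrow> 'a"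
    using assms(5)
  proof (elim disjE conjE)
    assume refl: "reflexive_banach TYPE('a)" and Q: "bounded Q" "closedin weak_topology Q"
    obtain G l where G: "G \<le> H" "G \<noteq> bot" "\<And>f :: 'a \<Rightarrow>\<^sub>L real. ((\<lambda>y. f (q y)) \<longlongrightarrow> f l) G"
      using reflexive_bounded_weak_cluster[OF refl Q(1) H] by blast
    have "l \<in> Q"
      by (rule weakly_closed_limit[OF Q(2) G(2) filter_leD[OF G(1) H(2)] G(3)])
    with G show ?thesis by blast
  next
    assume "compact Q"
    from compact_cluster_filter[OF this H] obtain G l
      where G: "G \<le> H" "G \<noteq> bot" "l \<in> Q" and lim: "(q \<longlongrightarrow> l) G" .
    have "((\<lambda>y. f (q y)) \<longlongrightarrow> f l) G" for f :: "'a \<Rightarrow>\<^sub>L real"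
      by (rule blinfun.tendsto[OF tendsto_const lim])
    with G show ?thesis by blast
  qed
  have "?T x \<le> Liminf (at x) ?T" for x
  proof (rule ccontr)
    assume "\<not> ?thesis"
    then obtain r' where r': "Liminf (at x) ?T < r'" "r' < ?T x"
      by (meson dense not_le)
    have "\<not> eventually (\<lambda>y. r' \<le> ?T y) (at x)"
      using Liminf_bounded[of r' ?T "at x"] r'(1) by (meson leD)
    then have freq: "\<exists>\<^sub>F y in at x. ?T y < r'"
      by (simp add: frequently_def not_less)
    then obtain y where "?T y < r'" by (auto dest: frequently_ex)
    \<comment> \<open>The level is positive since the minimal time is nonnegative, and finite since
      it lies strictly below \<open>?T x\<close>.\<close>
    then have "0 < r'" using minimal_time_nonneg by (rule le_less_trans[rotated])
    with r' obtain r where r: "r' = ereal r" "0 < r"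
      by (cases r') auto
    \<comment> \<open>This filter approaches \<open>x\<close> only through points with minimal time
      below the level; it is proper because such points occur frequently.\<close>
    let ?H = "inf (at x) (principal {y. ?T y < r'})"
    have H: "?H \<noteq> bot"
      using freq by (simp add: trivial_limit_def eventually_inf_principal frequently_def)
    have "\<exists>q. ?T y < r' \<longrightarrow> q \<in> Q \<and> q - y \<in> (*\<^sub>R) r ` F" for y
      using minimal_time_less_imp[OF assms(3) zero, of Q y r] r(1) by blast
    then obtain q where q: "\<And>y. ?T y < r' \<Longrightarrow> q y \<in> Q \<and> q y - y \<in> (*\<^sub>R) r ` F"
      by metis
    then have evQ: "eventually (\<lambda>y. q y \<in> Q) ?H" and evF: "eventually (\<lambda>y. q y - y \<in> (*\<^sub>R) r ` F) ?H"
      by (auto simp: eventually_inf_principal)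
    obtain G l where G: "G \<le> ?H" "G \<noteq> bot" and l: "l \<in> Q"
      and lim: "\<And>f :: 'a \<Rightarrow>\<^sub>L real. ((\<lambda>y. f (q y)) \<longlongrightarrow> f l) G"
      using cluster[OF H evQ] by blast
    have "G \<le> at x" using G(1) by simp
    then have id: "((\<lambda>y. y) \<longlongrightarrow> x) G" by (rule tendsto_mono) (rule tendsto_ident_at)
    \<comment> \<open>The differences \<open>q y - y\<close> stay in the fixed dilate of
      \<open>F\<close> and tend weakly to \<open>l - x\<close>, because \<open>y\<close> tends to
      \<open>x\<close> in norm along \<open>G\<close>.\<close>
    have "l - x \<in> (*\<^sub>R) r ` F"
    proof (rule closed_convex_weak_limit[OF _ _ G(2) filter_leD[OF G(1) evF]])
      show "closed ((*\<^sub>R) r ` F)" by (rule closed_scaling[OF assms(2)])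
      show "convex ((*\<^sub>R) r ` F)" by (rule convex_scaling[OF assms(3)])
      show "((\<lambda>y. f (q y - y)) \<longlongrightarrow> f (l - x)) G" for f :: "'a \<Rightarrow>\<^sub>L real"
        unfolding blinfun.diff_right
        by (intro tendsto_diff lim blinfun.tendsto tendsto_const id)
    qed
    then have "?T x \<le> r'"
      using minimal_time_le[OF _ l] r by simp
    with r'(2) show False by simp
  qed
  then show ?thesis by (simp add: lsc_def lsc_at_def)
qed

end
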